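(* Let $\mathcal C$ be a pointed category, regarded as an $\mathbb A$-coalgebra via $\beta_{\mathcal C}(a)=(!_a\colon a\to 0)$. The following conditions are equivalent. (i) The category $\mathcal C$ carries a normalized lax $\overline{\mathbb A}$-algebra structure. (ii) The category $\mathcal C$ has kernels.
   Context: All categories are small and the axiom of choice is assumed. A pointed category is a category with a chosen object $0$ that is both initial and terminal; $!_a\colon a\to 0$ and $!^a\colon 0\to a$ are the unique morphisms, and a zero morphism is one that factors through $0$. Kernels: $\mathcal C$ has (algebraic) kernels if for every morphism $f\colon a\to b$ there is a chosen morphism $\kappa_f\colon \ker f\to a$ such that (1) $f\kappa_f$ is the zero morphism; (2) $\kappa_{\mathrm{id}_a}=\,!^a$ and $\kappa_{!_a}=\mathrm{id}_a$ for every object $a$; (3) for every $g\colon c\to a$ with $fg$ the zero morphism there is a unique $h\colon c\to \ker f$ with $\kappa_f h=g$. Arrow comonad: $\mathbb A\colon \mathsf{Cat}\to\mathsf{Cat}$ is the 2-functor sending $\mathcal C$ to its arrow category $\mathbb A(\mathcal C)$ (objects: morphisms of $\mathcal C$; morphisms $f\to g$, for $f\colon a\to b$, $g\colon c\to d$: pairs $(h_0\colon a\to c,\ h_1\colon b\to d)$ with $gh_0=h_1f$), acting on functors in the evident way and on a natural transformation $\omega\colon F\Rightarrow G$ by $\mathbb A(\omega)_{f\colon a\to b}=(\omega_a,\omega_b)\colon F(f)\to G(f)$. It is a 2-comonad with counit $\epsilon_{\mathcal C}\colon\mathbb A(\mathcal C)\to\mathcal C$ the domain functor ($f\mapsto a$,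 $(h_0,h_1)\mapsto h_0$) and comultiplication $\delta_{\mathcal C}\colon \mathbb A(\mathcal C)\to\mathbb A^2(\mathcal C)$ sending $f\colon a\to b$ to the morphism $(f,\mathrm{id}_b)\colon f\to \mathrm{id}_b$ of $\mathbb A(\mathcal C)$, and $(h_0,h_1)\colon f\to g$ to the pair $\big((h_0,h_1)\colon f\to g,\ (h_1,h_1)\colon \mathrm{id}_b\to\mathrm{id}_d\big)$. A pointed category is an $\mathbb A$-coalgebra via $\beta_{\mathcal C}\colon\mathcal C\to\mathbb A(\mathcal C)$, $a\mapsto\,!_a$, $(f\colon a\to b)\mapsto (f,\mathrm{id}_0)\colon !_a\to\,!_b$. The induced 2-monad $\overline{\mathbb A}$ on $\mathbb A$-coalgebras sends $(\mathcal C,\beta_{\mathcal C})$ to $(\mathbb A(\mathcal C),\delta_{\mathcal C})$, with multiplication $\mu_{\mathcal C}=\mathbb A\epsilon_{\mathcal C}$ and unit $\eta_{\mathcal C}=\beta_{\mathcal C}$ (so $\eta_{\mathbb A(\mathcal C)}=\delta_{\mathcal C}$). A normalized lax $\overline{\mathbb A}$-algebra structure on $\mathcal C$ consists of a functor $\mathcal K\colon\mathbb A(\mathcal C)\to\mathcal C$ which is a morphism of $\mathbb A$-coalgebras, i.e. $\mathbb A\mathcal K\circ\delta_{\mathcal C}=\beta_{\mathcal C}\circ\mathcal K$, and a natural transformation $\phi\colon \mathcal K\circ\mathbb A\mathcal K\Rightarrow\mathcal K\circ\mathbb A\epsilon_{\mathcal C}$ such that: (i) $\mathcal K\circ\beta_{\mathcal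 C}=\mathrm{id}_{\mathcal C}$; (ii) $(\phi\cdot\mathbb A\epsilon_{\mathbb A(\mathcal C)})\,\square\,(\phi\cdot\mathbb A^2\mathcal K)=(\phi\cdot\mathbb A^2\epsilon_{\mathcal C})\,\square\,(\mathcal K\cdot\mathbb A\phi)$; (iii) $\phi\cdot\mathbb A\beta_{\mathcal C}=\mathrm{id}_{\mathcal K}$; (iv) $\phi\cdot\delta_{\mathcal C}=\mathrm{id}_{\mathcal K}$. Here $\cdot$ is horizontal composition (whiskering) and $\square$ is vertical composition (right factor first). *)

theory Defs
  imports Main
begin

section \<open>Small categories, functors, natural transformations\<close>

record ('o, 'm) cat =
  Obj :: "'o set"
  Arr :: "'m set"
  Dom :: "'m \<Rightarrow> 'o"
  Cod :: "'m \<Rightarrow> 'o"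
  Id :: "'o \<Rightarrow> 'm"
  Comp :: "'m \<Rightarrow> 'm \<Rightarrow> 'm"  (infixr "\<cdot>\<index>" 70)

definition hom :: "('o, 'm, 'z) cat_scheme \<Rightarrow> 'o \<Rightarrow> 'o \<Rightarrow> 'm set" where
  "hom C a b = {f \<in> Arr C. Dom C f = a \<and> Cod C f = b}"

text \<open>Composition is applicative: \<open>g \<cdot> f\<close> is \<open>f\<close> followed by \<open>g\<close>.\<close>

locale category =
  fixes C :: "('o, 'm, 'z) cat_scheme" (structure)
  assumes dom_obj: "f \<in> Arr C \<Longrightarrow> Dom C f \<in> Obj C"
    and cod_obj: "f \<in> Arr C \<Longrightarrow> Cod C f \<in> Obj C"
    and id_hom: "a \<in> Obj C \<Longrightarrow> Id C a \<in> hom C a a"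
    and comp_hom: "\<lbrakk>f \<in> hom C a b; g \<in> hom C b c\<rbrakk> \<Longrightarrow> g \<cdot> f \<in> hom C a c"
    and id_left: "f \<in> Arr C \<Longrightarrow> Id C (Cod C f) \<cdot> f = f"
    and id_right: "f \<in> Arr C \<Longrightarrow> f \<cdot> Id C (Dom C f) = f"
    and assoc: "\<lbrakk>f \<in> hom C a b; g \<in> hom C b c; h \<in> hom C c d\<rbrakk>
                  \<Longrightarrow> h \<cdot> (g \<cdot> f) = (h \<cdot> g) \<cdot> f"

record ('o, 'm, 'p, 'n) fun_data =
  OMap :: "'o \<Rightarrow> 'p"
  AMap :: "'m \<Rightarrow> 'n"

locale cat_functor = src: category C + tgt: category D
  for C :: "('o, 'm, 'y) cat_scheme" and D :: "('p, 'n, 'z) cat_scheme"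
    and F :: "('o, 'm, 'p, 'n) fun_data" +
  assumes obj_map: "a \<in> Obj C \<Longrightarrow> OMap F a \<in> Obj D"
    and arr_map: "f \<in> hom C a b \<Longrightarrow> AMap F f \<in> hom D (OMap F a) (OMap F b)"
    and id_map: "a \<in> Obj C \<Longrightarrow> AMap F (Id C a) = Id D (OMap F a)"
    and comp_map: "\<lbrakk>f \<in> hom C a b; g \<in> hom C b c\<rbrakk>
                     \<Longrightarrow> AMap F (g \<cdot>\<^bsub>C\<^esub> f) = AMap F g \<cdot>\<^bsub>D\<^esub> AMap F f"

definition id_fun :: "('o, 'm, 'o, 'm) fun_data" where
  "id_fun = \<lparr>OMap = (\<lambda>a. a), AMap = (\<lambda>f. f)\<rparr>"

definition comp_fun :: "('p, 'n, 'q, 'k) fun_data \<Rightarrow> ('o, 'm, 'p, 'n) fun_data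
    \<Rightarrow> ('o, 'm, 'q, 'k) fun_data"  (infixr "\<circ>\<^sub>F" 75) where
  "G \<circ>\<^sub>F F = \<lparr>OMap = OMap G \<circ> OMap F, AMap = AMap G \<circ> AMap F\<rparr>"

text \<open>Functors out of \<open>C\<close> are total HOL functions whose values outside the carriers of \<open>C\<close>
  are irrelevant; equality of functors is agreement on these carriers.\<close>

definition fun_eq :: "('o, 'm, 'z) cat_scheme \<Rightarrow> ('o, 'm, 'p, 'n) fun_data
    \<Rightarrow> ('o, 'm, 'p, 'n) fun_data \<Rightarrow> bool" where
  "fun_eq C F G \<longleftrightarrow> (\<forall>a \<in> Obj C. OMap F a = OMap G a) \<and> (\<forall>f \<in> Arr C. AMap F f = AMap G f)"

text \<open>A natural transformation is given by its family of components.\<close>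

locale nat_trans = src: cat_functor C D F + tgt: cat_functor C D G
  for C :: "('o, 'm, 'y) cat_scheme" and D :: "('p, 'n, 'z) cat_scheme"
    and F G :: "('o, 'm, 'p, 'n) fun_data" and \<omega> :: "'o \<Rightarrow> 'n" +
  assumes component: "a \<in> Obj C \<Longrightarrow> \<omega> a \<in> hom D (OMap F a) (OMap G a)"
    and natural: "f \<in> hom C a b \<Longrightarrow> AMap G f \<cdot>\<^bsub>D\<^esub> \<omega> a = \<omega> b \<cdot>\<^bsub>D\<^esub> AMap F f"

definition nt_eq :: "('o, 'm, 'z) cat_scheme \<Rightarrow> ('o \<Rightarrow> 'n) \<Rightarrow> ('o \<Rightarrow> 'n) \<Rightarrow> bool" where
  "nt_eq C \<omega> \<psi> \<longleftrightarrow> (\<forall>a \<in> Obj C. \<omega> a = \<psi> a)"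

definition id_nt :: "('p, 'n, 'z) cat_scheme \<Rightarrow> ('o, 'm, 'p, 'n) fun_data \<Rightarrow> 'o \<Rightarrow> 'n" where
  "id_nt D F = (\<lambda>a. Id D (OMap F a))"

text \<open>Vertical composition (right factor first) in the target category \<open>D\<close>, and the two
  whiskerings \<open>\<omega> \<cdot> F\<close> and \<open>K \<cdot> \<omega>\<close>.\<close>

definition vcomp :: "('p, 'n, 'z) cat_scheme \<Rightarrow> ('o \<Rightarrow> 'n) \<Rightarrow> ('o \<Rightarrow> 'n) \<Rightarrow> 'o \<Rightarrow> 'n" where
  "vcomp D \<psi> \<omega> = (\<lambda>a. \<psi> a \<cdot>\<^bsub>D\<^esub> \<omega> a)"

definition whisker_fun :: "('p \<Rightarrow> 'k) \<Rightarrow> ('o, 'm, 'p, 'n) fun_data \<Rightarrow> 'o \<Rightarrow> 'k" where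
  "whisker_fun \<omega> F = (\<lambda>a. \<omega> (OMap F a))"

definition fun_whisker :: "('p, 'n, 'q, 'k) fun_data \<Rightarrow> ('o \<Rightarrow> 'n) \<Rightarrow> 'o \<Rightarrow> 'k" where
  "fun_whisker K \<omega> = (\<lambda>a. AMap K (\<omega> a))"


section \<open>The arrow 2-comonad\<close>

text \<open>A morphism \<open>(h\<^sub>0, h\<^sub>1) : f \<rightarrow> g\<close> of the arrow category has to remember its domain and
  codomain; it is encoded as the quadruple \<open>(f, g, h\<^sub>0, h\<^sub>1)\<close>.\<close>

type_synonym 'm sq = "'m \<times> 'm \<times> 'm \<times> 'm"

definition arrow_cat :: "('o, 'm, 'z) cat_scheme \<Rightarrow> ('m, 'm sq) cat" where
  "arrow_cat C = \<lparr>
     Obj = Arr C,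
     Arr = {(f, g, h0, h1). f \<in> Arr C \<and> g \<in> Arr C \<and>
              h0 \<in> hom C (Dom C f) (Dom C g) \<and> h1 \<in> hom C (Cod C f) (Cod C g) \<and>
              g \<cdot>\<^bsub>C\<^esub> h0 = h1 \<cdot>\<^bsub>C\<^esub> f},
     Dom = (\<lambda>(f, g, h0, h1). f),
     Cod = (\<lambda>(f, g, h0, h1). g),
     Id = (\<lambda>f. (f, f, Id C (Dom C f), Id C (Cod C f))),
     Comp = (\<lambda>(f', g', k0, k1) (f, g, h0, h1). (f, g', k0 \<cdot>\<^bsub>C\<^esub> h0, k1 \<cdot>\<^bsub>C\<^esub> h1))\<rparr>"

definition arrow_fun :: "('o, 'm, 'p, 'n) fun_data \<Rightarrow> ('m, 'm sq, 'n, 'n sq) fun_data" where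
  "arrow_fun F = \<lparr>
     OMap = AMap F,
     AMap = (\<lambda>(f, g, h0, h1). (AMap F f, AMap F g, AMap F h0, AMap F h1))\<rparr>"

text \<open>The action on \<open>\<omega> : F \<Rightarrow> G\<close>, with \<open>C\<close> the common source of \<open>F\<close> and \<open>G\<close>.\<close>

definition arrow_nt :: "('o, 'm, 'z) cat_scheme \<Rightarrow> ('o, 'm, 'p, 'n) fun_data
    \<Rightarrow> ('o, 'm, 'p, 'n) fun_data \<Rightarrow> ('o \<Rightarrow> 'n) \<Rightarrow> 'm \<Rightarrow> 'n sq" where
  "arrow_nt C F G \<omega> = (\<lambda>f. (AMap F f, AMap G f, \<omega> (Dom C f), \<omega> (Cod C f)))"

definition counit :: "('o, 'm, 'z) cat_scheme \<Rightarrow> ('m, 'm sq, 'o, 'm) fun_data" where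
  "counit C = \<lparr>OMap = Dom C, AMap = (\<lambda>(f, g, h0, h1). h0)\<rparr>"

definition comult :: "('o, 'm, 'z) cat_scheme \<Rightarrow> ('m, 'm sq, 'm sq, 'm sq sq) fun_data" where
  "comult C =
     (let d = (\<lambda>f. (f, Id C (Cod C f), f, Id C (Cod C f)))
      in \<lparr>OMap = d,
          AMap = (\<lambda>(f, g, h0, h1).
            (d f, d g, (f, g, h0, h1), (Id C (Cod C f), Id C (Cod C g), h1, h1)))\<rparr>)"

text \<open>Strict coalgebras of the comonad and their strict morphisms.\<close>

locale coalgebra = cat_functor C "arrow_cat C" \<beta>
  for C :: "('o, 'm, 'z) cat_scheme" and \<beta> :: "('o, 'm, 'm, 'm sq) fun_data" +
  assumes counit_law: "fun_eq C (counit C \<circ>\<^sub>F \<beta>) id_fun"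
    and comult_law: "fun_eq C (arrow_fun \<beta> \<circ>\<^sub>F \<beta>) (comult C \<circ>\<^sub>F \<beta>)"

locale coalgebra_morphism =
  src_coalg: coalgebra C \<beta> + tgt_coalg: coalgebra D \<gamma> + cat_functor C D F
  for C :: "('o, 'm, 'y) cat_scheme" and \<beta> :: "('o, 'm, 'm, 'm sq) fun_data"
    and D :: "('p, 'n, 'z) cat_scheme" and \<gamma> :: "('p, 'n, 'n, 'n sq) fun_data"
    and F :: "('o, 'm, 'p, 'n) fun_data" +
  assumes preserves_coaction: "fun_eq C (arrow_fun F \<circ>\<^sub>F \<beta>) (\<gamma> \<circ>\<^sub>F F)"


section \<open>Normalized lax algebras of the induced 2-monad\<close>

text \<open>The induced 2-monad sends a coalgebra \<open>(C, \<beta>)\<close> to \<open>(arrow_cat C, comult C)\<close>; its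
  multiplication at \<open>(C, \<beta>)\<close> is \<open>arrow_fun (counit C)\<close> and its unit is \<open>\<beta>\<close>.\<close>

locale normalized_lax_algebra =
  coalgebra_morphism "arrow_cat C" "comult C" C \<beta> K +
  lax: nat_trans "arrow_cat (arrow_cat C)" C
    "K \<circ>\<^sub>F arrow_fun K" "K \<circ>\<^sub>F arrow_fun (counit C)" \<phi>
  for C :: "('o, 'm, 'z) cat_scheme" and \<beta> :: "('o, 'm, 'm, 'm sq) fun_data"
    and K :: "('m, 'm sq, 'o, 'm) fun_data" and \<phi> :: "'m sq \<Rightarrow> 'm" +
  assumes unit_law: "fun_eq C (K \<circ>\<^sub>F \<beta>) id_fun"
    and assoc_coherence:
      "nt_eq (arrow_cat (arrow_cat (arrow_cat C)))
         (vcomp C (whisker_fun \<phi> (arrow_fun (counit (arrow_cat C))))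
                  (whisker_fun \<phi> (arrow_fun (arrow_fun K))))
         (vcomp C (whisker_fun \<phi> (arrow_fun (arrow_fun (counit C))))
                  (fun_whisker K (arrow_nt (arrow_cat (arrow_cat C))
                     (K \<circ>\<^sub>F arrow_fun K) (K \<circ>\<^sub>F arrow_fun (counit C)) \<phi>)))"
    and unit_coherence_arrow:
      "nt_eq (arrow_cat C) (whisker_fun \<phi> (arrow_fun \<beta>)) (id_nt C K)"
    and unit_coherence_comult:
      "nt_eq (arrow_cat C) (whisker_fun \<phi> (comult C)) (id_nt C K)"


section \<open>Pointed categories and kernels\<close>

record ('o, 'm) pointed_cat = "('o, 'm) cat" +
  Zero :: 'o

locale pointed_category = category C
  for C :: "('o, 'm, 'z) pointed_cat_scheme" (structure) +
  assumes zero_obj: "Zero C \<in> Obj C"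
    and terminal: "a \<in> Obj C \<Longrightarrow> \<exists>!f. f \<in> hom C a (Zero C)"
    and initial: "a \<in> Obj C \<Longrightarrow> \<exists>!f. f \<in> hom C (Zero C) a"

definition to_zero :: "('o, 'm, 'z) pointed_cat_scheme \<Rightarrow> 'o \<Rightarrow> 'm" where
  "to_zero C a = (THE f. f \<in> hom C a (Zero C))"

definition from_zero :: "('o, 'm, 'z) pointed_cat_scheme \<Rightarrow> 'o \<Rightarrow> 'm" where
  "from_zero C a = (THE f. f \<in> hom C (Zero C) a)"

definition zero_morphism :: "('o, 'm, 'z) pointed_cat_scheme \<Rightarrow> 'm \<Rightarrow> bool" where
  "zero_morphism C f \<longleftrightarrow>
     (\<exists>p \<in> hom C (Dom C f) (Zero C). \<exists>q \<in> hom C (Zero C) (Cod C f). f = q \<cdot>\<^bsub>C\<^esub> p)"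

definition pointed_coaction :: "('o, 'm, 'z) pointed_cat_scheme \<Rightarrow> ('o, 'm, 'm, 'm sq) fun_data"
  where
  "pointed_coaction C = \<lparr>
     OMap = to_zero C,
     AMap = (\<lambda>f. (to_zero C (Dom C f), to_zero C (Cod C f), f, Id C (Zero C)))\<rparr>"

text \<open>A choice of kernels is a function \<open>\<kappa>\<close> on morphisms; the object \<open>ker f\<close> is \<open>Dom C (\<kappa> f)\<close>.\<close>

locale kernel_structure = pointed_category C
  for C :: "('o, 'm, 'z) pointed_cat_scheme" (structure) +
  fixes \<kappa> :: "'m \<Rightarrow> 'm"
  assumes kernel_arr: "f \<in> Arr C \<Longrightarrow> \<kappa> f \<in> Arr C \<and> Cod C (\<kappa> f) = Dom C f"
    and kernel_zero: "f \<in> Arr C \<Longrightarrow> zero_morphism C (f \<cdot> \<kappa> f)"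
    and kernel_id: "a \<in> Obj C \<Longrightarrow> \<kappa> (Id C a) = from_zero C a"
    and kernel_to_zero: "a \<in> Obj C \<Longrightarrow> \<kappa> (to_zero C a) = Id C a"
    and kernel_universal:
      "\<lbrakk>f \<in> Arr C; g \<in> hom C c (Dom C f); zero_morphism C (f \<cdot> g)\<rbrakk>
         \<Longrightarrow> \<exists>!h. h \<in> hom C c (Dom C (\<kappa> f)) \<and> \<kappa> f \<cdot> h = g"

definition has_kernels :: "('o, 'm, 'z) pointed_cat_scheme \<Rightarrow> bool" where
  "has_kernels C \<longleftrightarrow> (\<exists>\<kappa>. kernel_structure C \<kappa>)"

definition carries_normalized_lax_algebra :: "('o, 'm, 'z) pointed_cat_scheme \<Rightarrow> bool" where
  "carries_normalized_lax_algebra C \<longleftrightarrow>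
     (\<exists>K \<phi>. normalized_lax_algebra C (pointed_coaction C) K \<phi>)"

end

theory Submission imports Defs begin

text \<open>Given kernels, \<open>K\<close> sends \<open>f\<close> to \<open>ker f\<close>, and \<open>\<phi>\<close> at a square \<open>\<sigma> = (h\<^sub>0, h\<^sub>1) : f \<rightarrow> g\<close> is the
  factorization of \<open>\<kappa>\<^sub>f \<cdot> \<kappa>\<^sub>K\<^sub>\<sigma>\<close> through the kernel of \<open>h\<^sub>0\<close>; every equation between
  morphisms into a kernel may be checked after composing with the monomorphism \<open>\<kappa>\<close>.

  Conversely, the kernel of \<open>f : a \<rightarrow> b\<close> is \<open>K\<close> applied to the square \<open>(id, !\<^sub>b) : f \<rightarrow> !\<^sub>a\<close>. A morphism
  \<open>g : c \<rightarrow> a\<close> killed by \<open>f\<close> is a square \<open>!\<^sub>c \<rightarrow> f\<close>, and applying \<open>K\<close> to it yields the factorization.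
  Uniqueness comes from the naturality of \<open>\<phi>\<close> and its two unit laws, which say that the
  square \<open>!\<^sub>c \<rightarrow> f\<close> given by \<open>\<kappa>\<^sub>f\<close>, for \<open>c = K f\<close>, is sent to the identity.\<close>

section \<open>Arrow categories\<close>

lemma hom_iff: "f \<in> hom C a b \<longleftrightarrow> f \<in> Arr C \<and> Dom C f = a \<and> Cod C f = b"
  by (auto simp: hom_def)

context category
begin

declare dom_obj [simp] cod_obj [simp] id_left [simp] id_right [simp]

lemma id_arr [simp]:
  assumes "a \<in> Obj C"
  shows "Id C a \<in> Arr C" and "Dom C (Id C a) = a" and "Cod C (Id C a) = a"
  using id_hom[OF assms] by (auto simp: hom_iff)

lemma comp_arr [simp]:
  assumes "f \<in> Arr C" and "g \<in> Arr C" and "Cod C f = Dom C g"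
  shows "g \<cdot> f \<in> Arr C" and "Dom C (g \<cdot> f) = Dom C f" and "Cod C (g \<cdot> f) = Cod C g"
  using comp_hom[of f "Dom C f" "Cod C f" g "Cod C g"] assms by (auto simp: hom_iff)

lemma comp_assoc:
  assumes "f \<in> Arr C" and "g \<in> Arr C" and "h \<in> Arr C"
    and "Cod C f = Dom C g" and "Cod C g = Dom C h"
  shows "(h \<cdot> g) \<cdot> f = h \<cdot> (g \<cdot> f)"
  using assoc[of f "Dom C f" "Cod C f" g "Cod C g" h "Cod C h"] assms by (auto simp: hom_iff)

lemma id_left' [simp]: "\<lbrakk>f \<in> Arr C; Cod C f = b\<rbrakk> \<Longrightarrow> Id C b \<cdot> f = f"
  and id_right' [simp]: "\<lbrakk>f \<in> Arr C; Dom C f = a\<rbrakk> \<Longrightarrow> f \<cdot> Id C a = f"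
  by auto

end

lemma arrow_cat_simps [simp]:
  "Obj (arrow_cat C) = Arr C"
  "Dom (arrow_cat C) (f, g, h0, h1) = f"
  "Cod (arrow_cat C) (f, g, h0, h1) = g"
  "Id (arrow_cat C) f = (f, f, Id C (Dom C f), Id C (Cod C f))"
  "(f', g', k0, k1) \<cdot>\<^bsub>arrow_cat C\<^esub> (f, g, h0, h1) = (f, g', k0 \<cdot>\<^bsub>C\<^esub> h0, k1 \<cdot>\<^bsub>C\<^esub> h1)"
  by (simp_all add: arrow_cat_def)

lemma arr_arrow_cat:
  "(f, g, h0, h1) \<in> Arr (arrow_cat C) \<longleftrightarrow>
     f \<in> Arr C \<and> g \<in> Arr C \<and> h0 \<in> Arr C \<and> Dom C h0 = Dom C f \<and> Cod C h0 = Dom C g \<and>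
     h1 \<in> Arr C \<and> Dom C h1 = Cod C f \<and> Cod C h1 = Cod C g \<and> g \<cdot>\<^bsub>C\<^esub> h0 = h1 \<cdot>\<^bsub>C\<^esub> f"
  by (auto simp: arrow_cat_def hom_iff)

lemma category_arrow_cat:
  assumes "category C"
  shows "category (arrow_cat C)"
proof -
  interpret category C by fact
  show ?thesis
  proof
    fix s t a b c
    assume "s \<in> hom (arrow_cat C) a b" "t \<in> hom (arrow_cat C) b c"
    \<comment> \<open>Each quadruple stores its own ends, so membership in the hom-sets forces the
      primed components to be \<open>a\<close>, \<open>b\<close>, \<open>b\<close>,
      \<open>c\<close>.\<close>
    moreover obtain a' b' h0 h1 b'' c' k0 k1 where "s = (a', b', h0, h1)" "t = (b'', c', k0, k1)"
      by (metis prod_cases4)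
    ultimately have eq: "s = (a, b, h0, h1)" "t = (b, c, k0, k1)"
      and s: "(a, b, h0, h1) \<in> Arr (arrow_cat C)" and t: "(b, c, k0, k1) \<in> Arr (arrow_cat C)"
      by (auto simp: hom_iff)
    \<comment> \<open>Pasting two commuting squares: \<open>t\<close> is used first, then
      \<open>s\<close>.\<close>
    have "c \<cdot>\<^bsub>C\<^esub> (k0 \<cdot>\<^bsub>C\<^esub> h0) = (k1 \<cdot>\<^bsub>C\<^esub> b) \<cdot>\<^bsub>C\<^esub> h0"
      using s t comp_assoc[of h0 k0 c] by (simp add: arr_arrow_cat)
    also have "\<dots> = (k1 \<cdot>\<^bsub>C\<^esub> h1) \<cdot>\<^bsub>C\<^esub> a"
      using s t comp_assoc[of h0 b k1] comp_assoc[of a h1 k1] by (simp add: arr_arrow_cat)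
    finally show "t \<cdot>\<^bsub>arrow_cat C\<^esub> s \<in> hom (arrow_cat C) a c"
      using s t by (simp add: eq hom_iff arr_arrow_cat)
  qed (auto simp: hom_iff arr_arrow_cat comp_assoc)
qed

section \<open>Functoriality of the arrow construction, counit and comultiplication\<close>

lemma arrow_fun_simps [simp]:
  "OMap (arrow_fun F) = AMap F"
  "AMap (arrow_fun F) (f, g, h0, h1) = (AMap F f, AMap F g, AMap F h0, AMap F h1)"
  by (simp_all add: arrow_fun_def)

lemma counit_simps [simp]:
  "OMap (counit C) = Dom C"
  "AMap (counit C) (f, g, h0, h1) = h0"
  by (simp_all add: counit_def)

lemma comult_simps [simp]:
  "OMap (comult C) f = (f, Id C (Cod C f), f, Id C (Cod C f))"
  "AMap (comult C) (f, g, h0, h1) =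
     (OMap (comult C) f, OMap (comult C) g, (f, g, h0, h1),
      (Id C (Cod C f), Id C (Cod C g), h1, h1))"
  by (simp_all add: comult_def Let_def)

lemma comp_fun_simps [simp]:
  "OMap (G \<circ>\<^sub>F F) a = OMap G (OMap F a)"
  "AMap (G \<circ>\<^sub>F F) f = AMap G (AMap F f)"
  by (simp_all add: comp_fun_def)

lemma id_fun_simps [simp]: "OMap id_fun a = a" "AMap id_fun f = f"
  by (simp_all add: id_fun_def)

context cat_functor
begin

lemma arr_map' [simp]:
  assumes "f \<in> Arr C"
  shows "AMap F f \<in> Arr D" and "Dom D (AMap F f) = OMap F (Dom C f)"
    and "Cod D (AMap F f) = OMap F (Cod C f)"
  using arr_map[of f "Dom C f" "Cod C f"] assms by (auto simp: hom_iff)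

lemma comp_map':
  assumes "f \<in> Arr C" and "g \<in> Arr C" and "Cod C f = Dom C g"
  shows "AMap F (g \<cdot>\<^bsub>C\<^esub> f) = AMap F g \<cdot>\<^bsub>D\<^esub> AMap F f"
  using comp_map[of f "Dom C f" "Cod C f" g "Cod C g"] assms by (auto simp: hom_iff)

end

lemma cat_functor_comp:
  assumes "cat_functor C D F" and "cat_functor D E G"
  shows "cat_functor C E (G \<circ>\<^sub>F F)"
proof -
  interpret F: cat_functor C D F by fact
  interpret G: cat_functor D E G by fact
  show ?thesis
    by unfold_locales (auto simp: hom_iff F.obj_map G.obj_map F.id_map G.id_map F.comp_map' G.comp_map')
qed

lemma cat_functor_arrow_fun:
  assumes "cat_functor C D F"
  shows "cat_functor (arrow_cat C) (arrow_cat D) (arrow_fun F)"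
proof -
  interpret F: cat_functor C D F by fact
  interpret AC: category "arrow_cat C" by (rule category_arrow_cat) unfold_locales
  interpret AD: category "arrow_cat D" by (rule category_arrow_cat) unfold_locales
  show ?thesis
  proof
    fix f a b
    assume "f \<in> hom (arrow_cat C) a b"
    then show "AMap (arrow_fun F) f \<in> hom (arrow_cat D) (OMap (arrow_fun F) a) (OMap (arrow_fun F) b)"
      by (cases f) (auto simp: hom_iff arr_arrow_cat simp flip: F.comp_map')
  qed (auto simp: hom_iff arr_arrow_cat F.id_map F.comp_map')
qed

lemma cat_functor_counit:
  assumes "category C"
  shows "cat_functor (arrow_cat C) C (counit C)"
proof -
  interpret category C by fact
  interpret AC: category "arrow_cat C" by (rule category_arrow_cat) fact
  show ?thesis
    by unfold_locales (auto simp: hom_iff arr_arrow_cat)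
qed

lemma cat_functor_comult:
  assumes "category C"
  shows "cat_functor (arrow_cat C) (arrow_cat (arrow_cat C)) (comult C)"
proof -
  interpret category C by fact
  interpret AC: category "arrow_cat C" by (rule category_arrow_cat) fact
  interpret AAC: category "arrow_cat (arrow_cat C)" by (rule category_arrow_cat) unfold_locales
  show ?thesis
    by unfold_locales (auto simp: hom_iff arr_arrow_cat)
qed

text \<open>The cofree coalgebra on \<open>C\<close>: its two laws are a counit law and the
  coassociativity law of the comonad. It is the source of the coalgebra morphism
  \<open>K\<close>.\<close>

lemma coalgebra_comult:
  assumes "category C"
  shows "coalgebra (arrow_cat C) (comult C)"
proof -
  interpret category C by fact
  interpret cat_functor "arrow_cat C" "arrow_cat (arrow_cat C)" "comult C"
    by (rule cat_functor_comult) fact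
  show ?thesis
    by unfold_locales (auto simp: fun_eq_def arr_arrow_cat)
qed

section \<open>Pointed categories\<close>

lemma pointed_coaction_simps [simp]:
  "OMap (pointed_coaction C) a = to_zero C a"
  "AMap (pointed_coaction C) f = (to_zero C (Dom C f), to_zero C (Cod C f), f, Id C (Zero C))"
  by (simp_all add: pointed_coaction_def)

context pointed_category
begin

declare zero_obj [simp]

lemma to_zero_arr [simp]:
  assumes "a \<in> Obj C"
  shows "to_zero C a \<in> Arr C" and "Dom C (to_zero C a) = a" and "Cod C (to_zero C a) = Zero C"
  using theI'[OF terminal[OF assms]] by (auto simp: to_zero_def hom_iff)

lemma from_zero_arr [simp]:
  assumes "a \<in> Obj C"
  shows "from_zero C a \<in> Arr C" and "Dom C (from_zero C a) = Zero C" and "Cod C (from_zero C a) = a"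
  using theI'[OF initial[OF assms]] by (auto simp: from_zero_def hom_iff)

lemma to_zero_eqI:
  assumes "f \<in> Arr C" and "Cod C f = Zero C"
  shows "f = to_zero C (Dom C f)"
  using terminal[of "Dom C f"] assms by (metis dom_obj hom_iff to_zero_arr)

lemma from_zero_eqI:
  assumes "f \<in> Arr C" and "Dom C f = Zero C"
  shows "f = from_zero C (Cod C f)"
  using initial[of "Cod C f"] assms by (metis cod_obj hom_iff from_zero_arr)

text \<open>Settles any equation between composites ending at 0 by comparing their domains
  only.\<close>

lemma arrow_to_zero_unique:
  assumes "f \<in> Arr C" "g \<in> Arr C" "Cod C f = Zero C" "Cod C g = Zero C" "Dom C f = Dom C g"
  shows "f = g"
  using to_zero_eqI[of f] to_zero_eqI[of g] assms by simp

lemma arrow_from_zero_unique: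
  assumes "f \<in> Arr C" "g \<in> Arr C" "Dom C f = Zero C" "Dom C g = Zero C" "Cod C f = Cod C g"
  shows "f = g"
  using from_zero_eqI[of f] from_zero_eqI[of g] assms by simp

lemma to_zero_Zero [simp]: "to_zero C (Zero C) = Id C (Zero C)"
  by (rule arrow_to_zero_unique) simp_all

section \<open>Zero morphisms and their stability under composition\<close>

lemma zero_morphism_iff:
  assumes "f \<in> Arr C"
  shows "zero_morphism C f \<longleftrightarrow> f = from_zero C (Cod C f) \<cdot> to_zero C (Dom C f)"
proof
  assume "zero_morphism C f"
  then obtain p q where "p \<in> hom C (Dom C f) (Zero C)" "q \<in> hom C (Zero C) (Cod C f)" and pq: "f = q \<cdot> p"
    unfolding zero_morphism_def by blast
  then have "p = to_zero C (Dom C f)" "q = from_zero C (Cod C f)"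
    using to_zero_eqI[of p] from_zero_eqI[of q] by (simp_all only: hom_iff)
  then have "q \<cdot> p = from_zero C (Cod C f) \<cdot> to_zero C (Dom C f)"
    by (rule arg_cong2[where f = "\<lambda>p q. q \<cdot> p"])
  with pq show "f = from_zero C (Cod C f) \<cdot> to_zero C (Dom C f)"
    by (rule trans)
next
  assume "f = from_zero C (Cod C f) \<cdot> to_zero C (Dom C f)"
  moreover have "to_zero C (Dom C f) \<in> hom C (Dom C f) (Zero C)"
    "from_zero C (Cod C f) \<in> hom C (Zero C) (Cod C f)"
    using assms by (auto simp: hom_iff)
  ultimately show "zero_morphism C f"
    unfolding zero_morphism_def by blast
qed

lemma zero_morphism_comp:
  assumes "p \<in> Arr C" "q \<in> Arr C" "Cod C p = Zero C" "Dom C q = Zero C"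
  shows "zero_morphism C (q \<cdot> p)"
  unfolding zero_morphism_def using assms by (intro bexI[of _ p] bexI[of _ q]) (auto simp: hom_iff)

lemma zero_morphismE:
  assumes "zero_morphism C f"
  obtains p q where "p \<in> Arr C" "q \<in> Arr C" "Dom C p = Dom C f" "Cod C p = Zero C"
    "Dom C q = Zero C" "Cod C q = Cod C f" "f = q \<cdot> p"
proof -
  obtain p q where "p \<in> hom C (Dom C f) (Zero C)" "q \<in> hom C (Zero C) (Cod C f)" "f = q \<cdot> p"
    using assms unfolding zero_morphism_def by blast
  then show thesis
    using that unfolding hom_iff by blast
qed

lemma zero_morphism_comp_right:
  assumes "zero_morphism C f" "f \<in> Arr C" "g \<in> Arr C" "Cod C g = Dom C f"
  shows "zero_morphism C (f \<cdot> g)"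
  using assms(1)
proof (rule zero_morphismE)
  fix p q
  assume pq: "p \<in> Arr C" "q \<in> Arr C" "Dom C p = Dom C f" "Cod C p = Zero C"
    "Dom C q = Zero C" and eq: "f = q \<cdot> p"
  have "(q \<cdot> p) \<cdot> g = q \<cdot> (p \<cdot> g)"
    using pq assms by (intro comp_assoc) simp_all
  then have "f \<cdot> g = q \<cdot> (p \<cdot> g)"
    by (simp only: eq[symmetric])
  moreover have "zero_morphism C (q \<cdot> (p \<cdot> g))"
    using pq assms by (intro zero_morphism_comp) simp_all
  ultimately show ?thesis by simp
qed

lemma zero_morphism_comp_left:
  assumes "zero_morphism C f" "f \<in> Arr C" "g \<in> Arr C" "Cod C f = Dom C g"
  shows "zero_morphism C (g \<cdot> f)"
  using assms(1)
proof (rule zero_morphismE)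
  fix p q
  assume pq: "p \<in> Arr C" "q \<in> Arr C" "Cod C p = Zero C" "Dom C q = Zero C"
    "Cod C q = Cod C f" and eq: "f = q \<cdot> p"
  have "(g \<cdot> q) \<cdot> p = g \<cdot> (q \<cdot> p)"
    using pq assms by (intro comp_assoc) simp_all
  then have "g \<cdot> f = (g \<cdot> q) \<cdot> p"
    by (simp only: eq[symmetric])
  moreover have "zero_morphism C ((g \<cdot> q) \<cdot> p)"
    using pq assms by (intro zero_morphism_comp) simp_all
  ultimately show ?thesis by simp
qed

text \<open>The squares involved end at 0 and so commute by terminality; the comultiplication law
  also needs \<open>to_zero_Zero\<close>, since \<open>comult\<close> produces an identity where the
  coaction produces \<open>to_zero C (Zero C)\<close>.\<close>

lemma coalgebra_pointed_coaction: "coalgebra C (pointed_coaction C)"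
proof -
  interpret AC: category "arrow_cat C" by (rule category_arrow_cat) unfold_locales
  show ?thesis
  proof
    fix a assume "a \<in> Obj C"
    then show "AMap (pointed_coaction C) (Id C a) = Id (arrow_cat C) (OMap (pointed_coaction C) a)"
      by auto
  next
    fix f a b assume "f \<in> hom C a b"
    then show "AMap (pointed_coaction C) f
        \<in> hom (arrow_cat C) (OMap (pointed_coaction C) a) (OMap (pointed_coaction C) b)"
      by (auto simp: hom_iff arr_arrow_cat intro!: arrow_to_zero_unique)
  qed (auto simp: hom_iff arr_arrow_cat fun_eq_def)
qed

end

section \<open>From kernels to lax algebras\<close>

context kernel_structure
begin

lemma kernel_arr' [simp]:
  assumes "f \<in> Arr C"
  shows "\<kappa> f \<in> Arr C" and "Cod C (\<kappa> f) = Dom C f"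
  using kernel_arr[OF assms] by auto

lemma zero_morphism_kernel_comp:
  assumes "f \<in> Arr C" "h \<in> Arr C" "Cod C h = Dom C (\<kappa> f)"
  shows "zero_morphism C (f \<cdot> (\<kappa> f \<cdot> h))"
  using zero_morphism_comp_right[OF kernel_zero[OF assms(1)], of h] assms by (simp add: comp_assoc)

text \<open>The common composite is killed by \<open>f\<close>, so the uniqueness half of the
  universal property applies to its two factorizations.\<close>

lemma kernel_monic:
  assumes "f \<in> Arr C" "h \<in> Arr C" "h' \<in> Arr C" "Cod C h = Dom C (\<kappa> f)" "Cod C h' = Dom C (\<kappa> f)"
    and "Dom C h = Dom C h'" and "\<kappa> f \<cdot> h = \<kappa> f \<cdot> h'"
  shows "h = h'"
proof -
  have "\<exists>!k. k \<in> hom C (Dom C h) (Dom C (\<kappa> f)) \<and> \<kappa> f \<cdot> k = \<kappa> f \<cdot> h"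
    using zero_morphism_kernel_comp[of f h] assms
    by (intro kernel_universal) (auto simp: hom_iff)
  moreover have "h \<in> hom C (Dom C h) (Dom C (\<kappa> f))" "h' \<in> hom C (Dom C h) (Dom C (\<kappa> f))"
    using assms by (auto simp: hom_iff)
  ultimately show ?thesis
    using assms(7) by auto
qed

definition lift :: "'m \<Rightarrow> 'm \<Rightarrow> 'm" where
  "lift f g = (THE h. h \<in> hom C (Dom C g) (Dom C (\<kappa> f)) \<and> \<kappa> f \<cdot> h = g)"

lemma lift:
  assumes "f \<in> Arr C" "g \<in> Arr C" "Cod C g = Dom C f" "zero_morphism C (f \<cdot> g)"
  shows "lift f g \<in> Arr C" and "Dom C (lift f g) = Dom C g"
    and "Cod C (lift f g) = Dom C (\<kappa> f)" and "\<kappa> f \<cdot> lift f g = g"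
  using theI'[OF kernel_universal[of f g "Dom C g"]] assms by (auto simp: lift_def hom_iff)

text \<open>Commutativity of the square trades \<open>g \<cdot> h0\<close> for
  \<open>h1 \<cdot> f\<close>, and \<open>f \<cdot> \<kappa> f\<close> is zero. This makes the lift
  in \<open>ker_map\<close> exist.\<close>

lemma comp_kernel_zero:
  assumes "(f, g, h0, h1) \<in> Arr (arrow_cat C)"
  shows "zero_morphism C (g \<cdot> (h0 \<cdot> \<kappa> f))"
proof -
  have "g \<cdot> (h0 \<cdot> \<kappa> f) = h1 \<cdot> (f \<cdot> \<kappa> f)"
    using assms by (auto simp: arr_arrow_cat simp flip: comp_assoc)
  then show ?thesis
    using assms zero_morphism_comp_left[OF kernel_zero, of f h1] by (auto simp: arr_arrow_cat)
qed

section \<open>The kernel functor on the arrow category\<close>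

definition ker_map :: "'m sq \<Rightarrow> 'm" where
  "ker_map = (\<lambda>(f, g, h0, h1). lift g (h0 \<cdot> \<kappa> f))"

definition ker :: "('m, 'm sq, 'o, 'm) fun_data" where
  "ker = \<lparr>OMap = (\<lambda>f. Dom C (\<kappa> f)), AMap = ker_map\<rparr>"

lemma ker_simps [simp]:
  "OMap ker f = Dom C (\<kappa> f)"
  "AMap ker = ker_map"
  by (simp_all add: ker_def)

lemma ker_map:
  assumes "(f, g, h0, h1) \<in> Arr (arrow_cat C)"
  shows "ker_map (f, g, h0, h1) \<in> Arr C"
    and "Dom C (ker_map (f, g, h0, h1)) = Dom C (\<kappa> f)"
    and "Cod C (ker_map (f, g, h0, h1)) = Dom C (\<kappa> g)"
    and "\<kappa> g \<cdot> ker_map (f, g, h0, h1) = h0 \<cdot> \<kappa> f"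
  using lift[of g "h0 \<cdot> \<kappa> f"] comp_kernel_zero[OF assms] assms
  by (auto simp: ker_map_def arr_arrow_cat)

lemma ker_map_eqI:
  assumes "(f, g, h0, h1) \<in> Arr (arrow_cat C)" "k \<in> Arr C" "Dom C k = Dom C (\<kappa> f)"
    "Cod C k = Dom C (\<kappa> g)" "\<kappa> g \<cdot> k = h0 \<cdot> \<kappa> f"
  shows "ker_map (f, g, h0, h1) = k"
  using assms ker_map[OF assms(1)] by - (rule kernel_monic[of g], auto simp: arr_arrow_cat)

text \<open>Phrased with a free \<open>z\<close> so that the simplifier can replace
  \<open>\<kappa> f \<cdot> x\<close> by its known value inside a longer, right-associated
  composite.\<close>

lemma kernel_postcomp:
  assumes "f \<in> Arr C" "x \<in> Arr C" "y \<in> Arr C" "Cod C x = Dom C (\<kappa> f)" "Cod C y = Dom C x"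
    "\<kappa> f \<cdot> x = z"
  shows "\<kappa> f \<cdot> (x \<cdot> y) = z \<cdot> y"
  using assms by (simp flip: comp_assoc)

text \<open>Identities and composites satisfy the defining equation of the induced map, which has
  only one solution.\<close>

lemma cat_functor_ker: "cat_functor (arrow_cat C) C ker"
proof -
  interpret AC: category "arrow_cat C" by (rule category_arrow_cat) unfold_locales
  show ?thesis
  proof
    fix f a b assume "f \<in> hom (arrow_cat C) a b"
    then show "AMap ker f \<in> hom C (OMap ker a) (OMap ker b)"
      by (cases f) (auto simp: hom_iff ker_map arr_arrow_cat)
  next
    fix a assume "a \<in> Obj (arrow_cat C)"
    then show "AMap ker (Id (arrow_cat C) a) = Id C (OMap ker a)"
      by (auto intro!: ker_map_eqI simp: arr_arrow_cat)
  next
    fix s t a b c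
    assume st: "s \<in> hom (arrow_cat C) a b" "t \<in> hom (arrow_cat C) b c"
    have "t \<cdot>\<^bsub>arrow_cat C\<^esub> s \<in> Arr (arrow_cat C)"
      using AC.comp_hom[OF st] by (simp add: hom_iff)
    moreover obtain h0 h1 k0 k1 where eq: "s = (a, b, h0, h1)" "t = (b, c, k0, k1)"
      using st by (cases s; cases t) (auto simp: hom_iff)
    moreover have s: "(a, b, h0, h1) \<in> Arr (arrow_cat C)" and t: "(b, c, k0, k1) \<in> Arr (arrow_cat C)"
      using st eq by (auto simp: hom_iff)
    moreover have "\<kappa> c \<cdot> (ker_map t \<cdot> ker_map s) = (k0 \<cdot> h0) \<cdot> \<kappa> a"
      using ker_map[OF s] ker_map[OF t] s t eq
      by (auto simp: arr_arrow_cat kernel_postcomp comp_assoc)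
    ultimately show "AMap ker (t \<cdot>\<^bsub>arrow_cat C\<^esub> s) = AMap ker t \<cdot> AMap ker s"
      using ker_map[OF s] ker_map[OF t] by (auto intro!: ker_map_eqI)
  qed (auto simp: hom_iff)
qed

section \<open>The lax associativity cell\<close>

definition ker_comp :: "'m sq \<Rightarrow> 'm" where
  "ker_comp = (\<lambda>(f, g, h0, h1). lift h0 (\<kappa> f \<cdot> \<kappa> (ker_map (f, g, h0, h1))))"

text \<open>With \<open>k\<close> the induced map of kernels, \<open>h0 \<cdot> \<kappa> f\<close>
  equals \<open>\<kappa> g \<cdot> k\<close>, and \<open>k \<cdot> \<kappa> k\<close> is zero; so
  \<open>\<kappa> f \<cdot> \<kappa> k\<close> lifts to the kernel of \<open>h0\<close>.\<close>

lemma ker_comp: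
  assumes sq: "(f, g, h0, h1) \<in> Arr (arrow_cat C)"
  shows "ker_comp (f, g, h0, h1) \<in> Arr C"
    and "Dom C (ker_comp (f, g, h0, h1)) = Dom C (\<kappa> (ker_map (f, g, h0, h1)))"
    and "Cod C (ker_comp (f, g, h0, h1)) = Dom C (\<kappa> h0)"
    and "\<kappa> h0 \<cdot> ker_comp (f, g, h0, h1) = \<kappa> f \<cdot> \<kappa> (ker_map (f, g, h0, h1))"
proof -
  let ?k = "ker_map (f, g, h0, h1)"
  have "h0 \<cdot> (\<kappa> f \<cdot> \<kappa> ?k) = \<kappa> g \<cdot> (?k \<cdot> \<kappa> ?k)"
    using sq ker_map[OF sq] by (auto simp: arr_arrow_cat simp flip: comp_assoc)
  moreover have "zero_morphism C (\<kappa> g \<cdot> (?k \<cdot> \<kappa> ?k))"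
    using sq ker_map[OF sq]
    by - (rule zero_morphism_comp_left[OF kernel_zero], auto simp: arr_arrow_cat)
  ultimately have "zero_morphism C (h0 \<cdot> (\<kappa> f \<cdot> \<kappa> ?k))" by simp
  then show "ker_comp (f, g, h0, h1) \<in> Arr C"
    and "Dom C (ker_comp (f, g, h0, h1)) = Dom C (\<kappa> (ker_map (f, g, h0, h1)))"
    and "Cod C (ker_comp (f, g, h0, h1)) = Dom C (\<kappa> h0)"
    and "\<kappa> h0 \<cdot> ker_comp (f, g, h0, h1) = \<kappa> f \<cdot> \<kappa> (ker_map (f, g, h0, h1))"
    using lift[of h0 "\<kappa> f \<cdot> \<kappa> ?k"] sq ker_map[OF sq]
    by (auto simp: ker_comp_def arr_arrow_cat)
qed

lemma ker_comp_eqI: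
  assumes "(f, g, h0, h1) \<in> Arr (arrow_cat C)" "k \<in> Arr C"
    "Dom C k = Dom C (\<kappa> (ker_map (f, g, h0, h1)))" "Cod C k = Dom C (\<kappa> h0)"
    "\<kappa> h0 \<cdot> k = \<kappa> f \<cdot> \<kappa> (ker_map (f, g, h0, h1))"
  shows "ker_comp (f, g, h0, h1) = k"
  using assms ker_comp[OF assms(1)] by - (rule kernel_monic[of h0], auto simp: arr_arrow_cat)

text \<open>An arrow of the double arrow category is a commuting cube. Functoriality alone turns it
  into a commuting square of kernels.\<close>

lemma ker_map_arrow:
  assumes "(s, t, u, v) \<in> Arr (arrow_cat (arrow_cat C))"
  shows "(ker_map s, ker_map t, ker_map u, ker_map v) \<in> Arr (arrow_cat C)"
proof -
  interpret cat_functor "arrow_cat (arrow_cat C)" "arrow_cat C" "arrow_fun ker"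
    by (rule cat_functor_arrow_fun[OF cat_functor_ker])
  show ?thesis using arr_map'[OF assms] by simp
qed

text \<open>The face of the cube formed by the domains of \<open>f\<close>, \<open>g\<close>,
  \<open>f'\<close>, \<open>g'\<close>, again by functoriality.\<close>

lemma counit_arrow:
  assumes "((f, g, h0, h1), (f', g', h0', h1'), (p, p', p0, p1), (q, q', q0, q1))
    \<in> Arr (arrow_cat (arrow_cat C))"
  shows "(h0, h0', p0, q0) \<in> Arr (arrow_cat C)"
proof -
  interpret cat_functor "arrow_cat (arrow_cat C)" "arrow_cat C" "arrow_fun (counit C)"
    by (intro cat_functor_arrow_fun cat_functor_counit category_axioms)
  show ?thesis using arr_map'[OF assms] by simp
qed

text \<open>Adjacent faces of the cube share edges, which the encoding stores more than once;
  matching domains and codomains identifies the copies.\<close>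

lemma arr_arrow_arrow_catD:
  assumes "((f, g, h0, h1), (f', g', h0', h1'), (p, p', p0, p1), (q, q', q0, q1))
    \<in> Arr (arrow_cat (arrow_cat C))"
  shows "p = f" "p' = f'" "q = g" "q' = g'"
    "(f, g, h0, h1) \<in> Arr (arrow_cat C)" "(f', g', h0', h1') \<in> Arr (arrow_cat C)"
    "(f, f', p0, p1) \<in> Arr (arrow_cat C)" "(g, g', q0, q1) \<in> Arr (arrow_cat C)"
  \<comment> \<open>The instance opens only the outer arrow category, so the four faces stay
    folded.\<close>
  using assms unfolding arr_arrow_cat[of _ _ _ _ "arrow_cat C"] arrow_cat_simps by blast+

lemma arr_arrow_arrow_catE:
  assumes "c \<in> Arr (arrow_cat (arrow_cat C))"
  obtains f g h0 h1 f' g' h0' h1' p0 p1 q0 q1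
  where "c = ((f, g, h0, h1), (f', g', h0', h1'), (f, f', p0, p1), (g, g', q0, q1))"
proof -
  obtain f g h0 h1 f' g' h0' h1' p p' p0 p1 q q' q0 q1
    where c: "c = ((f, g, h0, h1), (f', g', h0', h1'), (p, p', p0, p1), (q, q', q0, q1))"
    by (metis prod_cases4)
  show thesis
    using that c arr_arrow_arrow_catD(1-4)[OF assms[unfolded c]] by simp
qed

text \<open>After composing with the monomorphism \<open>\<kappa> h0'\<close>, both sides become
  \<open>p0 \<cdot> (\<kappa> f \<cdot> \<kappa> (ker_map ?s))\<close>.\<close>

lemma ker_comp_natural:
  assumes "((f, g, h0, h1), (f', g', h0', h1'), (f, f', p0, p1), (g, g', q0, q1))
    \<in> Arr (arrow_cat (arrow_cat C))" (is "(?s, ?t, ?u, ?v) \<in> _")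
  shows "ker_map (h0, h0', p0, q0) \<cdot> ker_comp ?s =
    ker_comp ?t \<cdot> ker_map (ker_map ?s, ker_map ?t, ker_map ?u, ker_map ?v)"
proof -
  note K = ker_map_arrow[OF assms] and H = counit_arrow[OF assms]
    and sq = arr_arrow_arrow_catD(5-8)[OF assms]
  note k = ker_map[OF K] ker_map[OF H] ker_map[OF sq(1)] ker_map[OF sq(2)] ker_map[OF sq(3)]
    ker_comp[OF sq(1)] ker_comp[OF sq(2)]
  have "\<kappa> h0' \<cdot> (ker_map (h0, h0', p0, q0) \<cdot> ker_comp ?s) = p0 \<cdot> (\<kappa> f \<cdot> \<kappa> (ker_map ?s))"
    using k sq H by (auto simp: arr_arrow_cat kernel_postcomp comp_assoc)
  moreover have "\<kappa> h0' \<cdot> (ker_comp ?t \<cdot> ker_map (ker_map ?s, ker_map ?t, ker_map ?u, ker_map ?v))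
      = \<kappa> f' \<cdot> (ker_map ?u \<cdot> \<kappa> (ker_map ?s))"
    using k sq H by (auto simp: arr_arrow_cat kernel_postcomp comp_assoc)
  moreover have "\<dots> = p0 \<cdot> (\<kappa> f \<cdot> \<kappa> (ker_map ?s))"
    using k sq H by (auto simp: arr_arrow_cat kernel_postcomp comp_assoc)
  ultimately show ?thesis
    using k sq H by - (rule kernel_monic[of h0'], auto simp: arr_arrow_cat)
qed

text \<open>Composed with \<open>\<kappa> p0\<close>, both sides become the iterated inclusion
  \<open>\<kappa> f \<cdot> \<kappa> (ker_map ?s) \<cdot> \<kappa> ?X\<close> into the domain of
  \<open>f\<close>.\<close>

lemma ker_comp_coherence:
  assumes "((f, g, h0, h1), (f', g', h0', h1'), (f, f', p0, p1), (g, g', q0, q1))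
    \<in> Arr (arrow_cat (arrow_cat C))" (is "(?s, ?t, ?u, ?v) \<in> _")
  shows "ker_comp ?u \<cdot> ker_comp (ker_map ?s, ker_map ?t, ker_map ?u, ker_map ?v) =
    ker_comp (h0, h0', p0, q0) \<cdot>
      ker_map (ker_map (ker_map ?s, ker_map ?t, ker_map ?u, ker_map ?v),
               ker_map (h0, h0', p0, q0), ker_comp ?s, ker_comp ?t)"
    (is "_ = _ \<cdot> ker_map ?w")
proof -
  note K = ker_map_arrow[OF assms] and H = counit_arrow[OF assms]
    and sq = arr_arrow_arrow_catD(5-8)[OF assms]
  note k = ker_map[OF K] ker_map[OF H] ker_map[OF sq(1)] ker_map[OF sq(2)] ker_map[OF sq(3)]
    ker_map[OF sq(4)] ker_comp[OF sq(1)] ker_comp[OF sq(2)] ker_comp[OF sq(3)]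
    ker_comp[OF K] ker_comp[OF H]
  let ?K = "(ker_map ?s, ker_map ?t, ker_map ?u, ker_map ?v)" and ?H = "(h0, h0', p0, q0)"
  let ?X = "ker_map ?K"
  \<comment> \<open>The commutativity of this square is exactly naturality of
    \<open>ker_comp\<close> at the cube.\<close>
  have w: "?w \<in> Arr (arrow_cat C)"
    using k ker_comp_natural[OF assms] by (simp add: arr_arrow_cat)
  note kw = ker_map[OF w]
  have ar: "f \<in> Arr C" "h0 \<in> Arr C" "p0 \<in> Arr C" "Dom C h0 = Dom C f" "Dom C p0 = Dom C f"
    using sq(1,3) by (simp_all add: arr_arrow_cat)
  have "\<kappa> p0 \<cdot> (ker_comp ?u \<cdot> ker_comp ?K) = (\<kappa> f \<cdot> \<kappa> (ker_map ?u)) \<cdot> ker_comp ?K"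
    by (rule kernel_postcomp) (simp_all add: k ar)
  also have "\<dots> = \<kappa> f \<cdot> (\<kappa> (ker_map ?u) \<cdot> ker_comp ?K)"
    by (rule comp_assoc) (simp_all add: k ar)
  also have "\<dots> = \<kappa> f \<cdot> (\<kappa> (ker_map ?s) \<cdot> \<kappa> ?X)"
    by (simp only: ker_comp(4)[OF K])
  also have "\<dots> = (\<kappa> f \<cdot> \<kappa> (ker_map ?s)) \<cdot> \<kappa> ?X"
    by (rule comp_assoc[symmetric]) (simp_all add: k ar)
  also have "\<dots> = \<kappa> h0 \<cdot> (ker_comp ?s \<cdot> \<kappa> ?X)"
    by (rule kernel_postcomp[symmetric]) (simp_all add: k ar)
  also have "\<dots> = \<kappa> h0 \<cdot> (\<kappa> (ker_map ?H) \<cdot> ker_map ?w)"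
    by (simp only: kw(4))
  also have "\<dots> = (\<kappa> h0 \<cdot> \<kappa> (ker_map ?H)) \<cdot> ker_map ?w"
    by (rule comp_assoc[symmetric]) (simp_all add: k kw ar)
  also have "\<dots> = \<kappa> p0 \<cdot> (ker_comp ?H \<cdot> ker_map ?w)"
    by (rule kernel_postcomp[symmetric]) (simp_all add: k kw ar)
  finally show ?thesis
    by - (rule kernel_monic[of p0], simp_all add: k kw ar)
qed

lemma normalized_lax_algebra_ker: "normalized_lax_algebra C (pointed_coaction C) ker ker_comp"
proof -
  interpret K: cat_functor "arrow_cat C" C ker by (rule cat_functor_ker)
  interpret coalgebra C "pointed_coaction C" by (rule coalgebra_pointed_coaction)
  interpret A: coalgebra "arrow_cat C" "comult C" by (rule coalgebra_comult) unfold_locales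
  interpret KAK: cat_functor "arrow_cat (arrow_cat C)" C "ker \<circ>\<^sub>F arrow_fun ker"
    by (rule cat_functor_comp[OF cat_functor_arrow_fun[OF cat_functor_ker] cat_functor_ker])
  interpret KAE: cat_functor "arrow_cat (arrow_cat C)" C "ker \<circ>\<^sub>F arrow_fun (counit C)"
    by (rule cat_functor_comp[OF cat_functor_arrow_fun[OF cat_functor_counit] cat_functor_ker])
      unfold_locales
  \<comment> \<open>Kernels of identities are 0. Together with \<open>map_to_zero\<close> this
    yields strict preservation of the coaction; \<open>map_beta\<close> below yields the unit
    law.\<close>
  have map_zero: "ker_map (Id C b, Id C d, h, h) = Id C (Zero C)"
    if "h \<in> Arr C" "Dom C h = b" "Cod C h = d" for h b d
  proof -
    have sq: "(Id C b, Id C d, h, h) \<in> Arr (arrow_cat C)"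
      using that by (auto simp: arr_arrow_cat)
    show ?thesis
      using that by (intro ker_map_eqI[OF sq]) (auto simp: kernel_id intro!: arrow_from_zero_unique)
  qed
  have map_to_zero: "ker_map (f, Id C b, f, Id C b) = to_zero C (Dom C (\<kappa> f))"
    if "f \<in> Arr C" "Cod C f = b" for f b
  proof -
    have sq: "(f, Id C b, f, Id C b) \<in> Arr (arrow_cat C)"
      using that by (auto simp: arr_arrow_cat)
    show ?thesis
      using that ker_map[OF sq] to_zero_eqI[of "ker_map (f, Id C b, f, Id C b)"]
      by (auto simp: kernel_id)
  qed
  have map_beta: "ker_map (to_zero C (Dom C f), to_zero C (Cod C f), f, Id C (Zero C)) = f"
    if "f \<in> Arr C" for f
    using that arr_map'[of f] by (intro ker_map_eqI) (auto simp: kernel_to_zero)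
  show ?thesis
  proof
    show "fun_eq (arrow_cat C) (arrow_fun ker \<circ>\<^sub>F comult C) (pointed_coaction C \<circ>\<^sub>F ker)"
      by (auto simp: fun_eq_def map_zero map_to_zero arr_arrow_cat ker_map)
  next
    fix s assume "s \<in> Obj (arrow_cat (arrow_cat C))"
    then show "ker_comp s \<in> hom C (OMap (ker \<circ>\<^sub>F arrow_fun ker) s) (OMap (ker \<circ>\<^sub>F arrow_fun (counit C)) s)"
      by (cases s) (auto simp: hom_iff ker_comp)
  next
    fix c s t assume "c \<in> hom (arrow_cat (arrow_cat C)) s t"
    then have c: "c \<in> Arr (arrow_cat (arrow_cat C))"
      and s: "s = Dom (arrow_cat (arrow_cat C)) c" and t: "t = Cod (arrow_cat (arrow_cat C)) c"
      by (auto simp: hom_iff)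
    from c show "AMap (ker \<circ>\<^sub>F arrow_fun (counit C)) c \<cdot> ker_comp s =
        ker_comp t \<cdot> AMap (ker \<circ>\<^sub>F arrow_fun ker) c"
      unfolding s t
      by (rule arr_arrow_arrow_catE) (use c in \<open>simp add: ker_comp_natural\<close>)
  next
    show "fun_eq C (ker \<circ>\<^sub>F pointed_coaction C) id_fun"
      by (auto simp: fun_eq_def map_beta kernel_to_zero)
  next
    show "nt_eq (arrow_cat (arrow_cat (arrow_cat C)))
         (vcomp C (whisker_fun ker_comp (arrow_fun (counit (arrow_cat C))))
                  (whisker_fun ker_comp (arrow_fun (arrow_fun ker))))
         (vcomp C (whisker_fun ker_comp (arrow_fun (arrow_fun (counit C))))
                  (fun_whisker ker (arrow_nt (arrow_cat (arrow_cat C))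
                     (ker \<circ>\<^sub>F arrow_fun ker) (ker \<circ>\<^sub>F arrow_fun (counit C)) ker_comp)))"
      unfolding nt_eq_def
    proof
      fix c assume "c \<in> Obj (arrow_cat (arrow_cat (arrow_cat C)))"
      then have c: "c \<in> Arr (arrow_cat (arrow_cat C))" by simp
      then show "vcomp C (whisker_fun ker_comp (arrow_fun (counit (arrow_cat C))))
                  (whisker_fun ker_comp (arrow_fun (arrow_fun ker))) c =
         vcomp C (whisker_fun ker_comp (arrow_fun (arrow_fun (counit C))))
                  (fun_whisker ker (arrow_nt (arrow_cat (arrow_cat C))
                     (ker \<circ>\<^sub>F arrow_fun ker) (ker \<circ>\<^sub>F arrow_fun (counit C)) ker_comp)) c"
        by (rule arr_arrow_arrow_catE)
          (use c in \<open>simp add: vcomp_def whisker_fun_def fun_whisker_def arrow_nt_def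
            ker_comp_coherence\<close>)
    qed
  next
    show "nt_eq (arrow_cat C) (whisker_fun ker_comp (arrow_fun (pointed_coaction C))) (id_nt C ker)"
      unfolding nt_eq_def
    proof
      fix f assume "f \<in> Obj (arrow_cat C)"
      then have f: "f \<in> Arr C" by simp
      then have "AMap (pointed_coaction C) f \<in> Arr (arrow_cat C)" by (rule arr_map')
      \<comment> \<open>Here the induced map is \<open>f\<close> itself and the outer inclusion is
        an identity, so the defining equation becomes
        \<open>\<kappa> f \<cdot> k = \<kappa> f\<close>.\<close>
      with f show "whisker_fun ker_comp (arrow_fun (pointed_coaction C)) f = id_nt C ker f"
        by (auto simp: whisker_fun_def id_nt_def map_beta kernel_to_zero intro!: ker_comp_eqI)
    qed
  next
    show "nt_eq (arrow_cat C) (whisker_fun ker_comp (comult C)) (id_nt C ker)"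
      unfolding nt_eq_def
    proof
      fix f assume "f \<in> Obj (arrow_cat C)"
      then have f: "f \<in> Arr C" by simp
      then have "OMap (comult C) f \<in> Arr (arrow_cat C)" by (auto simp: arr_arrow_cat)
      \<comment> \<open>Now the induced map goes to 0, so it is the inner inclusion that is an
        identity.\<close>
      with f show "whisker_fun ker_comp (comult C) f = id_nt C ker f"
        by (auto simp: whisker_fun_def id_nt_def map_to_zero kernel_to_zero intro!: ker_comp_eqI)
    qed
  qed
qed

end

section \<open>From lax algebras to kernels\<close>

locale pointed_lax_algebra =
  pointed_category C + normalized_lax_algebra C "pointed_coaction C" K \<phi>
  for C :: "('o, 'm, 'z) pointed_cat_scheme" (structure)
    and K :: "('m, 'm sq, 'o, 'm) fun_data" and \<phi> :: "'m sq \<Rightarrow> 'm"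
begin

lemma K_arr:
  assumes "(f, g, h0, h1) \<in> Arr (arrow_cat C)"
  shows "AMap K (f, g, h0, h1) \<in> Arr C" and "Dom C (AMap K (f, g, h0, h1)) = OMap K f"
    and "Cod C (AMap K (f, g, h0, h1)) = OMap K g"
  using arr_map'[OF assms] by simp_all

lemma K_comp:
  assumes "(f, g, h0, h1) \<in> Arr (arrow_cat C)" "(g, k, k0, k1) \<in> Arr (arrow_cat C)"
  shows "AMap K (g, k, k0, k1) \<cdot> AMap K (f, g, h0, h1) = AMap K (f, k, k0 \<cdot> h0, k1 \<cdot> h1)"
  using comp_map'[OF assms] by simp

lemma K_obj [simp]: "f \<in> Arr C \<Longrightarrow> OMap K f \<in> Obj C"
  using obj_map[of f] by simp

lemma K_to_zero [simp]: "a \<in> Obj C \<Longrightarrow> OMap K (to_zero C a) = a"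
  using unit_law by (auto simp: fun_eq_def)

lemma K_coaction:
  "f \<in> Arr C \<Longrightarrow> AMap K (to_zero C (Dom C f), to_zero C (Cod C f), f, Id C (Zero C)) = f"
  using unit_law by (auto simp: fun_eq_def)

text \<open>The object part of the condition that \<open>K\<close> is a morphism of
  coalgebras.\<close>

lemma K_comult: "f \<in> Arr C \<Longrightarrow>
    AMap K (f, Id C (Cod C f), f, Id C (Cod C f)) = to_zero C (OMap K f)"
  using preserves_coaction by (auto simp: fun_eq_def)

text \<open>Compare codomains in \<open>K_comult\<close> at \<open>Id C a\<close>: the left side
  ends at \<open>OMap K (Id C a)\<close>, the right side at 0.\<close>

lemma K_id [simp]:
  assumes "a \<in> Obj C"
  shows "OMap K (Id C a) = Zero C"
proof -
  have sq: "(Id C a, Id C a, Id C a, Id C a) \<in> Arr (arrow_cat C)"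
    using assms by (simp add: arr_arrow_cat)
  from assms K_arr[OF sq] K_comult[of "Id C a"] show ?thesis
    by (metis id_arr K_obj to_zero_arr(3))
qed

section \<open>Kernels extracted from the algebra structure\<close>

definition kernel :: "'m \<Rightarrow> 'm" where
  "kernel f = AMap K (f, to_zero C (Dom C f), Id C (Dom C f), to_zero C (Cod C f))"

lemma arrow_to_coaction:
  "f \<in> Arr C \<Longrightarrow> (f, to_zero C (Dom C f), Id C (Dom C f), to_zero C (Cod C f)) \<in> Arr (arrow_cat C)"
  by (auto simp: arr_arrow_cat intro!: arrow_to_zero_unique)

lemma coaction_arrow:
  "h \<in> Arr C \<Longrightarrow> (to_zero C (Dom C h), to_zero C (Cod C h), h, Id C (Zero C)) \<in> Arr (arrow_cat C)"
  by (auto simp: arr_arrow_cat intro!: arrow_to_zero_unique)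

text \<open>The canonical factorization of a zero morphism is the commutativity of this
  square.\<close>

lemma coaction_to_arrow:
  assumes "f \<in> Arr C" "g \<in> Arr C" "Cod C g = Dom C f" "zero_morphism C (f \<cdot> g)"
  shows "(to_zero C (Dom C g), f, g, from_zero C (Cod C f)) \<in> Arr (arrow_cat C)"
  using assms zero_morphism_iff[of "f \<cdot> g"] by (auto simp: arr_arrow_cat)

text \<open>The codomain comes from the unit law: \<open>K\<close> sends \<open>to_zero C a\<close>
  back to \<open>a\<close>.\<close>

lemma kernel_arr [simp]:
  assumes "f \<in> Arr C"
  shows "kernel f \<in> Arr C" "Dom C (kernel f) = OMap K f" "Cod C (kernel f) = Dom C f"
  using K_arr[OF arrow_to_coaction[OF assms]] assms by (auto simp: kernel_def)

text \<open>The composite is \<open>K\<close> of a square from \<open>f\<close> to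
  \<open>to_zero C ?b\<close> that also factors through \<open>Id C ?b\<close>, and \<open>K\<close>
  sends that identity to 0.\<close>

lemma kernel_zero:
  assumes f: "f \<in> Arr C"
  shows "zero_morphism C (f \<cdot> kernel f)"
proof -
  let ?b = "Cod C f"
  have sq1: "(f, Id C ?b, f, Id C ?b) \<in> Arr (arrow_cat C)"
    using f by (auto simp: arr_arrow_cat)
  have sq2: "(Id C ?b, to_zero C ?b, Id C ?b, to_zero C ?b) \<in> Arr (arrow_cat C)"
    using arrow_to_coaction[of "Id C ?b"] f by simp
  have "f \<cdot> kernel f = AMap K (to_zero C (Dom C f), to_zero C ?b, f, Id C (Zero C)) \<cdot> kernel f"
    using f by (simp add: K_coaction)
  also have "\<dots> = AMap K (f, to_zero C ?b, f, to_zero C ?b)"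
    using f K_comp[OF arrow_to_coaction[OF f] coaction_arrow[OF f]] by (simp add: kernel_def)
  also have "\<dots> = AMap K (Id C ?b, to_zero C ?b, Id C ?b, to_zero C ?b)
      \<cdot> AMap K (f, Id C ?b, f, Id C ?b)"
    using f K_comp[OF sq1 sq2] by simp
  finally show ?thesis
    using K_arr[OF sq1] K_arr[OF sq2] f by (auto intro!: zero_morphism_comp)
qed

text \<open>Naturality of \<open>\<phi>\<close> along the canonical arrow from \<open>f \<rightarrow> id\<close>, the value of the
  comultiplication at \<open>f\<close>, to \<open>!\<^sub>a \<rightarrow> !\<^sub>b\<close>, the value of the lifted coaction at \<open>f\<close>: both
  components of \<open>\<phi>\<close> are identities.\<close>

lemma K_kernel:
  assumes f: "f \<in> Arr C"
  shows "AMap K (to_zero C (OMap K f), f, kernel f, from_zero C (Cod C f)) = Id C (OMap K f)"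
proof -
  let ?b = "Cod C f"
  let ?s = "(f, Id C ?b, f, Id C ?b)"
  let ?t = "(to_zero C (Dom C f), to_zero C ?b, f, Id C (Zero C))"
  let ?u = "(f, to_zero C (Dom C f), Id C (Dom C f), to_zero C ?b)"
  let ?v = "(Id C ?b, to_zero C ?b, Id C ?b, to_zero C ?b)"
  have s: "?s \<in> Arr (arrow_cat C)"
    using f by (auto simp: arr_arrow_cat)
  have v: "?v \<in> Arr (arrow_cat C)"
    using arrow_to_coaction[of "Id C ?b"] f by simp
  have "(?s, ?t, ?u, ?v) \<in> hom (arrow_cat (arrow_cat C)) ?s ?t"
    using f s v arrow_to_coaction[OF f] coaction_arrow[OF f]
    by (simp add: hom_iff arr_arrow_cat[of _ _ _ _ "arrow_cat C"])
  \<comment> \<open>On the left the counit keeps only the domain face, an identity square on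
    \<open>f\<close>; on the right \<open>K\<close> applied to the four faces gives the square of
    the claim.\<close>
  from lax.natural[OF this]
  have nat: "AMap K (f, f, Id C (Dom C f), Id C ?b) \<cdot> \<phi> ?s =
      \<phi> ?t \<cdot> AMap K (AMap K ?s, AMap K ?t, AMap K ?u, AMap K ?v)"
    by simp
  have "\<phi> ?s = Id C (OMap K f)" "\<phi> ?t = Id C (OMap K f)"
    using unit_coherence_comult unit_coherence_arrow f
    by (auto simp: nt_eq_def whisker_fun_def id_nt_def)
  moreover have "AMap K (f, f, Id C (Dom C f), Id C ?b) = Id C (OMap K f)"
    using id_map[of f] f by simp
  \<comment> \<open>The square \<open>?v\<close> starts at an identity, so its image starts at 0 by
    \<open>K_id\<close>.\<close>
  moreover have "AMap K ?v = from_zero C ?b"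
    using K_arr[OF v] f from_zero_eqI[of "AMap K ?v"] by simp
  moreover have "AMap K ?s = to_zero C (OMap K f)" "AMap K ?t = f" "AMap K ?u = kernel f"
    using f by (simp_all add: K_comult K_coaction kernel_def)
  moreover have "(to_zero C (OMap K f), f, kernel f, from_zero C ?b) \<in> Arr (arrow_cat C)"
    using coaction_to_arrow[OF f _ _ kernel_zero[OF f]] f by simp
  ultimately show ?thesis
    using nat K_arr f by simp
qed

text \<open>Precompose the square of \<open>K_kernel\<close> with the coaction at \<open>h\<close>
  and use functoriality. Thus \<open>h\<close> is determined by
  \<open>kernel f \<cdot> h\<close>.\<close>

lemma kernel_reconstruct:
  assumes f: "f \<in> Arr C" and h: "h \<in> Arr C" "Cod C h = OMap K f"
  shows "AMap K (to_zero C (Dom C h), f, kernel f \<cdot> h, from_zero C (Cod C f)) = h"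
proof -
  have "(to_zero C (OMap K f), f, kernel f, from_zero C (Cod C f)) \<in> Arr (arrow_cat C)"
    using coaction_to_arrow[OF f _ _ kernel_zero[OF f]] f by simp
  from K_comp[OF _ this] coaction_arrow[OF h(1)] show ?thesis
    using f h K_kernel[OF f] K_coaction[OF h(1)] by simp
qed

lemma kernel_universal:
  assumes f: "f \<in> Arr C" and g: "g \<in> hom C c (Dom C f)" and z: "zero_morphism C (f \<cdot> g)"
  shows "\<exists>!h. h \<in> hom C c (Dom C (kernel f)) \<and> kernel f \<cdot> h = g"
proof
  have g': "g \<in> Arr C" "Dom C g = c" "Cod C g = Dom C f"
    using g by (auto simp: hom_iff)
  let ?h = "AMap K (to_zero C c, f, g, from_zero C (Cod C f))"
  have sq: "(to_zero C c, f, g, from_zero C (Cod C f)) \<in> Arr (arrow_cat C)"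
    using coaction_to_arrow[OF f, of g] z g' by simp
  \<comment> \<open>The lower edge of the composite square being this identity, that square is the
    coaction at \<open>g\<close>, which \<open>K\<close> sends to \<open>g\<close>.\<close>
  have "to_zero C (Cod C f) \<cdot> from_zero C (Cod C f) = Id C (Zero C)"
    using f by (intro arrow_from_zero_unique) auto
  then have "kernel f \<cdot> ?h = AMap K (to_zero C c, to_zero C (Dom C f), g, Id C (Zero C))"
    using K_comp[OF sq arrow_to_coaction[OF f]] g' by (simp add: kernel_def)
  also have "\<dots> = g" using K_coaction[OF g'(1)] g' by simp
  finally show "?h \<in> hom C c (Dom C (kernel f)) \<and> kernel f \<cdot> ?h = g"
    using K_arr[OF sq] f g' by (auto simp: hom_iff)
  show "h = ?h" if "h \<in> hom C c (Dom C (kernel f)) \<and> kernel f \<cdot> h = g" for h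
    using kernel_reconstruct[OF f, of h] that f by (auto simp: hom_iff)
qed

lemma kernel_structure_kernel: "kernel_structure C kernel"
proof
  fix f c g
  assume "f \<in> Arr C" "g \<in> hom C c (Dom C f)" "zero_morphism C (f \<cdot> g)"
  then show "\<exists>!h. h \<in> hom C c (Dom C (kernel f)) \<and> kernel f \<cdot> h = g"
    by (rule kernel_universal)
next
  fix a assume a: "a \<in> Obj C"
  then show "kernel (Id C a) = from_zero C a"
    using from_zero_eqI[of "kernel (Id C a)"] by simp
  \<comment> \<open>The defining square of this kernel is the coaction at
    \<open>Id C a\<close>.\<close>
  show "kernel (to_zero C a) = Id C a"
    using a K_coaction[of "Id C a"] by (simp add: kernel_def)
qed (simp_all add: kernel_zero)

end

theorem theorem8:
  fixes C :: "('o, 'm) pointed_cat"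
  assumes "pointed_category C"
  shows "carries_normalized_lax_algebra C \<longleftrightarrow> has_kernels C"
proof
  assume "carries_normalized_lax_algebra C"
  then obtain K \<phi> where "normalized_lax_algebra C (pointed_coaction C) K \<phi>"
    by (auto simp: carries_normalized_lax_algebra_def)
  with assms interpret pointed_lax_algebra C K \<phi>
    by (simp add: pointed_lax_algebra_def)
  show "has_kernels C"
    using kernel_structure_kernel by (auto simp: has_kernels_def)
next
  assume "has_kernels C"
  then obtain \<kappa> where "kernel_structure C \<kappa>" by (auto simp: has_kernels_def)
  then interpret kernel_structure C \<kappa> .
  show "carries_normalized_lax_algebra C"
    using normalized_lax_algebra_ker by (auto simp: carries_normalized_lax_algebra_def)
qed

end
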